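(* Let $H_n$ denote the number of binary words of length $n$ whose only square subwords are among $00$, $11$ and $0101$. Then $H_n=\Omega(1.0006^n)$ and $H_n=O(1.135^n)$.
   Context: A square is a nonempty word of the form $xx$, considered as a contiguous subword. *)

theory Defs
  imports Complex_Main "HOL-Library.Sublist" "HOL-Library.Landau_Symbols"
begin

definition is_square :: "'a list \<Rightarrow> bool" where
  "is_square s \<longleftrightarrow> (\<exists>x. x \<noteq> [] \<and> s = x @ x)"

definition binary_word :: "nat list \<Rightarrow> bool" where
  "binary_word w \<longleftrightarrow> set w \<subseteq> {0, 1}"

text \<open>The library predicate \<^const>\<open>sublist\<close> is the contiguous subword (factor) relation,
  not the scattered one.\<close>

definition H :: "nat \<Rightarrow> nat" where
  "H n = card {w. binary_word w \<and> length w = n \<and>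
     (\<forall>s. sublist s w \<and> is_square s \<longrightarrow> s \<in> {[0,0], [1,1], [0,1,0,1]})}"

end

theory Submission
  imports Defs
begin

text \<open>
  Upper bound: every admissible word of length 16 has, for some \<open>m \<le> 33\<close>, at most \<open>1.135 ^ m\<close>
  admissible extensions by \<open>m\<close> letters to the left. Splitting off such groups of \<open>m\<close> letters one after
  the other bounds \<open>H n\<close> by a multiple of \<open>1.135 ^ n\<close>.

  Lower bound: Leech's 13-uniform morphism yields arbitrarily long square-free ternary words in which
  every block contains the letter 0. A 67-uniform substitution with two images for the letter 0 and one
  for each of 1 and 2 maps square-free ternary words to binary words whose only squares are the three
  allowed ones. Hence \<open>H (871 * n) \<ge> 2 ^ n\<close>, where \<open>871 = 13 * 67\<close>, and
  \<open>2 powr (1 / 871) > 1.0006\<close>. For both substitutions a sufficiently long window determines its position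
  modulo the block length, so a long square has a period divisible by the block length and comes from a
  square in the preimage, while a short square lies in two consecutive blocks.
\<close>

section \<open>Squares in words\<close>

definition squares_within :: "'a list set \<Rightarrow> 'a list \<Rightarrow> bool" where
  "squares_within A w \<longleftrightarrow> (\<forall>s. sublist s w \<and> is_square s \<longrightarrow> s \<in> A)"

abbreviation square_free :: "'a list \<Rightarrow> bool" where
  "square_free \<equiv> squares_within {}"

lemma squares_within_sublist: "squares_within A w \<Longrightarrow> sublist v w \<Longrightarrow> squares_within A v"
  unfolding squares_within_def by (meson sublist_order.order.trans)

definition square_at :: "'a list \<Rightarrow> nat \<Rightarrow> nat \<Rightarrow> bool" where
  "square_at w i p \<longleftrightarrow>
     0 < p \<and> i + 2 * p \<le> length w \<and> take p (drop i w) = take p (drop (i + p) w)"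

lemma square_at_iff_nth:
  "square_at w i p \<longleftrightarrow>
     0 < p \<and> i + 2 * p \<le> length w \<and> (\<forall>j. i \<le> j \<and> j < i + p \<longrightarrow> w ! j = w ! (j + p))"
proof -
  have "(\<forall>j. i \<le> j \<and> j < i + p \<longrightarrow> w ! j = w ! (j + p)) \<longleftrightarrow> (\<forall>e<p. w ! (i + e) = w ! (i + e + p))"
    by (auto simp: le_iff_add)
  then show ?thesis
    by (auto simp: square_at_def list_eq_iff_nth_eq add.assoc add.commute[of p])
qed

lemma square_at_drop: "square_at (drop i w) 0 p \<longleftrightarrow> square_at w i p"
  by (auto simp: square_at_def add.commute)

lemma prefix_square_iff:
  "prefix s w \<and> is_square s \<longleftrightarrow> (\<exists>p. square_at w 0 p \<and> s = take (2 * p) w)"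
proof
  assume "prefix s w \<and> is_square s"
  then obtain x zs where "x \<noteq> []" "s = x @ x" "w = x @ x @ zs"
    by (auto simp: is_square_def prefix_def)
  then show "\<exists>p. square_at w 0 p \<and> s = take (2 * p) w"
    by (intro exI[of _ "length x"]) (simp add: square_at_def)
next
  assume "\<exists>p. square_at w 0 p \<and> s = take (2 * p) w"
  then obtain p where p: "square_at w 0 p" "s = take (2 * p) w" by blast
  then have "s = take p w @ take p w" "take p w \<noteq> []"
    by (auto simp: square_at_def mult_2 take_add)
  then have "is_square s" unfolding is_square_def by blast
  with p(2) show "prefix s w \<and> is_square s" by (simp add: take_is_prefix)
qed

lemma sublist_iff_prefix_drop: "sublist s w \<longleftrightarrow> (\<exists>i. prefix s (drop i w))"
  by (metis append_eq_conv_conj sublist_altdef' suffix_def suffix_drop)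

lemma sublist_square_iff:
  "sublist s w \<and> is_square s \<longleftrightarrow> (\<exists>i p. square_at w i p \<and> s = take (2 * p) (drop i w))"
  using prefix_square_iff[of s "drop _ w"] unfolding sublist_iff_prefix_drop square_at_drop by blast

lemma square_free_iff_square_at: "square_free w \<longleftrightarrow> (\<forall>i p. \<not> square_at w i p)"
  unfolding squares_within_def sublist_square_iff by blast

lemma square_free_adjacent_neq:
  assumes "square_free w" "Suc q < length w"
  shows "w ! q \<noteq> w ! Suc q"
proof
  assume "w ! q = w ! Suc q"
  then have "square_at w q 1"
    using assms(2) by (auto simp: square_at_iff_nth dest: le_less_Suc_eq)
  with assms(1) show False by (simp add: square_free_iff_square_at)
qed

subsection \<open>Listing all squares\<close>

text \<open>Conditionals instead of connectives, because \<open>code_simp\<close> evaluates both arguments of a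
  connective.\<close>

fun agree_upto :: "nat \<Rightarrow> 'a list \<Rightarrow> 'a list \<Rightarrow> bool" where
  "agree_upto 0 xs ys \<longleftrightarrow> True"
| "agree_upto (Suc p) (x # xs) (y # ys) \<longleftrightarrow> (if x = y then agree_upto p xs ys else False)"
| "agree_upto (Suc p) _ _ \<longleftrightarrow> False"

lemma agree_upto_iff:
  "agree_upto p xs ys \<longleftrightarrow> p \<le> length xs \<and> p \<le> length ys \<and> take p xs = take p ys"
  by (induction p xs ys rule: agree_upto.induct) auto

text \<open>The last argument loses two letters per step, which ends the search at half the length of \<open>w\<close>.\<close>

fun square_prefixes_from :: "nat \<Rightarrow> 'a list \<Rightarrow> 'a list \<Rightarrow> 'a list \<Rightarrow> 'a list list" where
  "square_prefixes_from p w (y # ys) (z # z' # zs) =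
     (if agree_upto p w (y # ys) then [take (2 * p) w] else []) @ square_prefixes_from (Suc p) w ys zs"
| "square_prefixes_from p w _ _ = []"

lemma square_prefixes_from_short: "length zs < 2 \<Longrightarrow> square_prefixes_from p w ys zs = []"
  by (induction p w ys zs rule: square_prefixes_from.induct) auto

lemma set_square_prefixes_from:
  "set (square_prefixes_from (Suc p) w (drop (Suc p) w) (drop (2 * p) w)) =
     {take (2 * q) w |q. square_at w 0 q \<and> p < q}"
proof (induction "length w - p" arbitrary: p rule: less_induct)
  case less
  show ?case
  proof (cases "2 * Suc p \<le> length w")
    case True
    let ?larger = "{take (2 * q) w |q. square_at w 0 q \<and> Suc p < q}"
    have rest: "set (square_prefixes_from (Suc (Suc p)) w
        (drop (Suc (Suc p)) w) (drop (2 * Suc p) w)) = ?larger"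
      using True by (intro less) simp
    have "drop (2 * p) w = w ! (2 * p) # w ! Suc (2 * p) # drop (2 * Suc p) w"
      using True by (simp add: Cons_nth_drop_Suc)
    moreover have tail: "drop (Suc p) w = w ! Suc p # drop (Suc (Suc p)) w"
      using True by (simp add: Cons_nth_drop_Suc)
    moreover have "agree_upto (Suc p) w (w ! Suc p # drop (Suc (Suc p)) w) \<longleftrightarrow> square_at w 0 (Suc p)"
      unfolding tail[symmetric] using True by (auto simp: agree_upto_iff square_at_def)
    ultimately have "set (square_prefixes_from (Suc p) w (drop (Suc p) w) (drop (2 * p) w)) =
        (if square_at w 0 (Suc p) then {take (2 * Suc p) w} else {}) \<union> ?larger"
      using rest by (simp del: mult_Suc_right)
    moreover have "p < q \<longleftrightarrow> q = Suc p \<or> Suc p < q" for q by auto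
    ultimately show ?thesis by (simp del: mult_Suc_right) blast
  next
    case False
    then have "\<not> square_at w 0 q" if "p < q" for q
      using that by (auto simp: square_at_def)
    with False show ?thesis by (auto simp: square_prefixes_from_short)
  qed
qed

definition square_prefixes :: "'a list \<Rightarrow> 'a list list" where
  "square_prefixes w = square_prefixes_from 1 w (tl w) w"

lemma set_square_prefixes: "set (square_prefixes w) = {s. prefix s w \<and> is_square s}"
  using set_square_prefixes_from[of 0 w]
  by (auto simp: square_prefixes_def prefix_square_iff drop_Suc square_at_def)

fun square_factors :: "'a list \<Rightarrow> 'a list list" where
  "square_factors [] = []"
| "square_factors (x # w) = square_prefixes (x # w) @ square_factors w"

lemma set_square_factors: "set (square_factors w) = {s. sublist s w \<and> is_square s}"
  by (induction w) (auto simp: set_square_prefixes sublist_Cons_right is_square_def)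

lemma squares_within_code [code]:
  "squares_within A w \<longleftrightarrow> list_all (\<lambda>s. s \<in> A) (square_factors w)"
  by (auto simp: squares_within_def list_all_iff set_square_factors)

section \<open>Growth of factorial languages\<close>

locale factorial_language =
  fixes alphabet :: "'a set" and L :: "'a list set"
  assumes finite_alphabet: "finite alphabet"
    and set_subset_alphabet: "w \<in> L \<Longrightarrow> set w \<subseteq> alphabet"
    and sublist_in_language: "w \<in> L \<Longrightarrow> sublist v w \<Longrightarrow> v \<in> L"
begin

definition complexity :: "nat \<Rightarrow> nat" where
  "complexity n = card {w \<in> L. length w = n}"

definition extensions :: "nat \<Rightarrow> 'a list \<Rightarrow> 'a list set" where
  "extensions n u = {x @ u |x. length x = n \<and> x @ u \<in> L}"

lemma complexity_eq_card_extensions: "complexity n = card (extensions n [])"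
  unfolding complexity_def extensions_def by (rule arg_cong[where f = card]) auto

lemma extensions_Suc: "extensions (Suc n) u = {c # w |c w. w \<in> extensions n u \<and> c # w \<in> L}"
proof -
  have "x @ u \<in> L" if "c # x @ u \<in> L" for c x
    using that by (rule sublist_in_language) (metis append_Cons append_Nil sublist_append_leftI)
  then show ?thesis
    by (fastforce simp: extensions_def length_Suc_conv)
qed

lemma extensions_not_in_language: "u \<notin> L \<Longrightarrow> extensions n u = {}"
  by (auto simp: extensions_def dest: sublist_in_language)

lemma extensions_subset_words:
  "extensions n u \<subseteq> (\<lambda>x. x @ u) ` {x. set x \<subseteq> alphabet \<and> length x = n}"
  using set_subset_alphabet by (fastforce simp: extensions_def)

lemma finite_extensions: "finite (extensions n u)"
  by (rule finite_subset[OF extensions_subset_words])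
     (simp add: finite_alphabet finite_lists_length_eq)

lemma card_extensions_le_power: "card (extensions n u) \<le> card alphabet ^ n"
proof -
  let ?X = "{x. set x \<subseteq> alphabet \<and> length x = n}"
  have "finite ?X" using finite_alphabet by (rule finite_lists_length_eq)
  then have "card (extensions n u) \<le> card ((\<lambda>x. x @ u) ` ?X)"
    by (intro card_mono extensions_subset_words) simp
  also have "\<dots> \<le> card ?X"
    using \<open>finite ?X\<close> by (rule card_image_le)
  also have "\<dots> = card alphabet ^ n"
    using finite_alphabet by (rule card_lists_length_eq)
  finally show ?thesis .
qed

lemma card_extensions_take: "card (extensions n u) \<le> card (extensions n (take l u))"
proof (rule card_inj_on_le)
  show "inj_on (\<lambda>w. take n w @ take l u) (extensions n u)"
  proof (rule inj_onI)
    fix v w assume "v \<in> extensions n u" "w \<in> extensions n u"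
    then obtain x y where "v = x @ u" "w = y @ u" "length x = n" "length y = n"
      unfolding extensions_def by blast
    moreover assume "take n v @ take l u = take n w @ take l u"
    ultimately show "v = w" by simp
  qed
  show "(\<lambda>w. take n w @ take l u) ` extensions n u \<subseteq> extensions n (take l u)"
  proof (rule image_subsetI)
    fix w assume "w \<in> extensions n u"
    then obtain x where x: "w = x @ u" "length x = n" "x @ u \<in> L"
      by (auto simp: extensions_def)
    have "sublist (x @ take l u) (x @ u)"
      using sublist_append_rightI[of "x @ take l u" "drop l u"] by simp
    with x have "x @ take l u \<in> L" by (blast intro: sublist_in_language)
    with x show "take n w @ take l u \<in> extensions n (take l u)"
      by (simp add: extensions_def)
  qed
qed (rule finite_extensions)

lemma extensions_add_subset: "extensions (m + n) u \<subseteq> (\<Union>v\<in>extensions m u. extensions n v)"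
proof
  fix w assume "w \<in> extensions (m + n) u"
  then obtain x where x: "w = x @ u" "length x = m + n" "w \<in> L"
    unfolding extensions_def by blast
  define y z where "y = take n x" and "z = drop n x"
  have yz: "w = y @ z @ u" "length y = n" "length z = m"
    using x by (simp_all add: y_def z_def)
  with \<open>w \<in> L\<close> have "z @ u \<in> L" by (auto intro: sublist_in_language)
  with yz x have "z @ u \<in> extensions m u" "w \<in> extensions n (z @ u)"
    unfolding extensions_def by blast+
  then show "w \<in> (\<Union>v\<in>extensions m u. extensions n v)" by blast
qed

lemma card_extensions_add_le:
  fixes K :: real
  assumes "\<And>v. v \<in> extensions m u \<Longrightarrow> card (extensions n v) \<le> K"
  shows "card (extensions (m + n) u) \<le> card (extensions m u) * K"
proof -
  have "card (extensions (m + n) u) \<le> card (\<Union>v\<in>extensions m u. extensions n v)"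
    using extensions_add_subset by (intro card_mono) (auto simp: finite_extensions)
  also have "\<dots> \<le> (\<Sum>v\<in>extensions m u. card (extensions n v))"
    by (intro card_UN_le finite_extensions)
  finally have "card (extensions (m + n) u) \<le> (\<Sum>v\<in>extensions m u. real (card (extensions n v)))"
    by (simp only: of_nat_sum[symmetric] of_nat_le_iff)
  also have "\<dots> \<le> card (extensions m u) * K"
    by (intro sum_bounded_above assms)
  finally show ?thesis .
qed

lemma card_extensions_le_Suc_power:
  assumes "n \<le> N"
  shows "card (extensions n u) \<le> (1 + real (card alphabet)) ^ N"
proof -
  have "card (extensions n u) \<le> real (card alphabet) ^ n"
    using card_extensions_le_power[of n u] by (simp flip: of_nat_power)
  also have "\<dots> \<le> (1 + real (card alphabet)) ^ n" by (rule power_mono) simp_all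
  also have "\<dots> \<le> (1 + real (card alphabet)) ^ N" using assms by (intro power_increasing) simp_all
  finally show ?thesis .
qed

lemma card_extensions_le_if_local_growth:
  fixes c :: real
  assumes "1 \<le> c" and "l \<le> length u"
    and local_growth: "\<And>v. v \<in> L \<Longrightarrow> length v = l \<Longrightarrow> \<exists>m\<in>{1..N}. card (extensions m v) \<le> c ^ m"
  shows "card (extensions n u) \<le> (1 + card alphabet) ^ N * c ^ n"
  using \<open>l \<le> length u\<close>
proof (induction n arbitrary: u rule: less_induct)
  case (less n)
  consider (short) "n \<le> N" | (outside) "u \<notin> L" | (long) "N \<le> n" "u \<in> L" by linarith
  then show ?case
  proof cases
    case short
    then have "card (extensions n u) \<le> (1 + real (card alphabet)) ^ N * 1"
      using card_extensions_le_Suc_power by simp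
    also have "\<dots> \<le> (1 + real (card alphabet)) ^ N * c ^ n"
      using \<open>1 \<le> c\<close> by (intro mult_left_mono one_le_power) simp_all
    finally show ?thesis by simp
  next
    case outside
    then show ?thesis using \<open>1 \<le> c\<close> by (simp add: extensions_not_in_language)
  next
    case long
    then have "take l u \<in> L" by (auto intro: sublist_in_language)
    moreover have "length (take l u) = l" using less.prems by simp
    ultimately obtain m where m: "m \<in> {1..N}" "card (extensions m (take l u)) \<le> c ^ m"
      using local_growth by blast
    let ?K = "(1 + card alphabet) ^ N * c ^ (n - m)"
    have "card (extensions (m + (n - m)) u) \<le> card (extensions m u) * ?K"
    proof (rule card_extensions_add_le)
      fix v assume "v \<in> extensions m u"
      then show "card (extensions (n - m) v) \<le> ?K"
        using m long less.prems by (intro less.IH) (auto simp: extensions_def)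
    qed
    also have "\<dots> \<le> c ^ m * ?K"
      using card_extensions_take[of m u l] m(2) \<open>1 \<le> c\<close> by (intro mult_right_mono) auto
    also have "\<dots> = (1 + card alphabet) ^ N * c ^ n"
      using m long by (simp add: power_add[symmetric])
    finally show ?thesis using m long by simp
  qed
qed

lemma complexity_bigo_if_local_growth:
  fixes c :: real
  assumes "1 \<le> c"
    and "\<And>v. v \<in> L \<Longrightarrow> length v = l \<Longrightarrow> \<exists>m\<in>{1..N}. card (extensions m v) \<le> c ^ m"
  shows "(\<lambda>n. real (complexity n)) \<in> O(\<lambda>n. c ^ n)"
proof (rule bigoI)
  let ?d = "1 + real (card alphabet)"
  have "complexity n \<le> ?d ^ l * ?d ^ N * norm (c ^ n)" if "l \<le> n" for n
  proof -
    have "card (extensions (l + (n - l)) []) \<le> card (extensions l []) * (?d ^ N * c ^ (n - l))"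
      using card_extensions_le_if_local_growth[OF assms(1) _ assms(2)]
      by (intro card_extensions_add_le) (auto simp: extensions_def)
    also have "\<dots> \<le> ?d ^ l * (?d ^ N * c ^ n)"
      using card_extensions_le_Suc_power[of l l "[]"] assms(1)
      by (intro mult_mono mult_left_mono power_increasing) simp_all
    finally show ?thesis using that assms(1) by (simp add: complexity_eq_card_extensions)
  qed
  then show "\<forall>\<^sub>F n in at_top. norm (real (complexity n)) \<le> ?d ^ l * ?d ^ N * norm (c ^ n)"
    by (intro eventually_at_top_linorderI[of l]) simp
qed

lemma complexity_add_le: "complexity (n + j) \<le> (1 + real (card alphabet)) ^ j * complexity n"
  using card_extensions_add_le[of n "[]" j, OF card_extensions_le_Suc_power[OF order.refl]]
  by (simp add: complexity_eq_card_extensions mult.commute)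

lemma complexity_bigomega_if_power_le:
  fixes b c :: real
  assumes "\<And>n. b ^ n \<le> complexity (k * n)" "0 < k" "1 \<le> c" "c ^ k \<le> b"
  shows "(\<lambda>n. real (complexity n)) \<in> \<Omega>(\<lambda>n. c ^ n)"
proof -
  let ?d = "1 + real (card alphabet)"
  have "c ^ n \<le> ?d ^ k * complexity n" for n
  proof -
    define q where "q = Suc (n div k)"
    have q: "n \<le> k * q" "k * q - n \<le> k"
      using mult_div_mod_eq[of k n] mod_less_divisor[OF \<open>0 < k\<close>, of n]
      unfolding q_def mult_Suc_right by linarith+
    have "c ^ n \<le> c ^ (k * q)" using q \<open>1 \<le> c\<close> by (intro power_increasing)
    also have "\<dots> = (c ^ k) ^ q" by (simp add: power_mult)
    also have "\<dots> \<le> b ^ q" using assms by (intro power_mono) auto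
    also have "\<dots> \<le> complexity (k * q)" by (rule assms(1))
    also have "\<dots> \<le> ?d ^ (k * q - n) * complexity n"
      using complexity_add_le[of n "k * q - n"] q by simp
    also have "\<dots> \<le> ?d ^ k * complexity n"
      using q by (intro mult_right_mono power_increasing) simp_all
    finally show ?thesis .
  qed
  then have "(\<lambda>n. c ^ n) \<in> O(\<lambda>n. real (complexity n))"
    using \<open>1 \<le> c\<close> by (intro bigoI[of _ "?d ^ k"] always_eventually allI) simp
  then show ?thesis by (simp only: bigomega_iff_bigo)
qed

end

section \<open>Upper bound\<close>

definition allowed_squares :: "nat list set" where
  "allowed_squares = {[0,0], [1,1], [0,1,0,1]}"

definition good :: "nat list \<Rightarrow> bool" where
  "good w \<longleftrightarrow> binary_word w \<and> squares_within allowed_squares w"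

lemma good_Cons_iff:
  "good (c # w) \<longleftrightarrow> c \<in> {0, 1} \<and> set (square_prefixes (c # w)) \<subseteq> allowed_squares \<and> good w"
  by (auto simp: good_def binary_word_def squares_within_def set_square_prefixes sublist_Cons_right)

interpretation good_words: factorial_language "{0, 1}" "{w. good w}"
proof
  show "v \<in> {w. good w}" if "w \<in> {w. good w}" "sublist v w" for v w
    using that set_mono_sublist[of v w] squares_within_sublist[of _ w v]
    by (auto simp: good_def binary_word_def)
qed (auto simp: good_def binary_word_def)

lemma H_eq_complexity: "H = good_words.complexity"
proof
  fix n
  have "H n = card {w. good w \<and> length w = n}"
    unfolding H_def good_def squares_within_def allowed_squares_def
    by (rule arg_cong[where f = card]) auto
  then show "H n = good_words.complexity n" by (simp add: good_words.complexity_def)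
qed

definition extend_left :: "nat list list \<Rightarrow> nat list list" where
  "extend_left ws =
     [c # w. w \<leftarrow> ws, c \<leftarrow> [0, 1], list_all (\<lambda>s. s \<in> allowed_squares) (square_prefixes (c # w))]"

lemma set_extend_left:
  assumes "\<forall>w\<in>set ws. good w"
  shows "set (extend_left ws) = {c # w |c w. w \<in> set ws \<and> good (c # w)}"
  using assms by (fastforce simp: extend_left_def good_Cons_iff list_all_iff)

lemma set_extend_left_funpow:
  "good u \<Longrightarrow> set ((extend_left ^^ n) [u]) = good_words.extensions n u"
proof (induction n)
  case 0
  then show ?case by (auto simp: good_words.extensions_def)
next
  case (Suc n)
  then have "\<forall>w\<in>set ((extend_left ^^ n) [u]). good w"
    by (auto simp: good_words.extensions_def)
  with Suc show ?case by (simp add: set_extend_left good_words.extensions_Suc)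
qed

text \<open>The list \<open>ws\<close> consists of the extensions by \<open>m - 1\<close> letters.\<close>

fun growth_within :: "int \<Rightarrow> int \<Rightarrow> nat \<Rightarrow> nat \<Rightarrow> nat list list \<Rightarrow> bool" where
  "growth_within a b 0 m ws \<longleftrightarrow> False"
| "growth_within a b (Suc n) m ws \<longleftrightarrow>
     (let ws' = extend_left ws in
      if int (length ws') * b ^ m \<le> a ^ m then True else growth_within a b n (Suc m) ws')"

lemma growth_withinD:
  assumes "growth_within a b n (Suc m) ((extend_left ^^ m) [u])" "good u" "0 < b"
  shows "\<exists>j\<in>{Suc m..m + n}. card (good_words.extensions j u) \<le> (real_of_int a / of_int b) ^ j"
  using assms(1)
proof (induction n arbitrary: m)
  case (Suc n)
  define ws where "ws = (extend_left ^^ Suc m) [u]"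
  show ?case
  proof (cases "int (length ws) * b ^ Suc m \<le> a ^ Suc m")
    case True
    have "card (good_words.extensions (Suc m) u) \<le> length ws"
      using card_length[of ws] set_extend_left_funpow[OF \<open>good u\<close>, of "Suc m"] by (simp add: ws_def)
    also have "length ws \<le> (real_of_int a / of_int b) ^ Suc m"
    proof -
      have "length ws * real_of_int b ^ Suc m = of_int (int (length ws) * b ^ Suc m)" by simp
      also have "\<dots> \<le> of_int (a ^ Suc m)" using True by (simp only: of_int_le_iff)
      finally show ?thesis
        using \<open>0 < b\<close> unfolding power_divide by (subst pos_le_divide_eq) simp_all
    qed
    finally show ?thesis by (intro bexI[of _ "Suc m"]) simp_all
  next
    case False
    with Suc.prems have "growth_within a b n (Suc (Suc m)) ((extend_left ^^ Suc m) [u])"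
      by (simp add: ws_def Let_def split: if_splits)
    from Suc.IH[OF this] show ?thesis by auto
  qed
qed simp

lemma growth_within_length_16:
  "list_all (\<lambda>u. growth_within 1135 1000 33 1 [u]) ((extend_left ^^ 16) [[]])"
  by code_simp

lemma ex_few_extensions:
  assumes "good v" "length v = 16"
  shows "\<exists>m\<in>{1..33}. card (good_words.extensions m v) \<le> (1.135 :: real) ^ m"
proof -
  have "good []" using good_words.sublist_in_language[of v "[]"] assms(1) by simp
  then have "v \<in> set ((extend_left ^^ 16) [[]])"
    using assms by (simp only: set_extend_left_funpow) (simp add: good_words.extensions_def)
  then have "growth_within 1135 1000 33 (Suc 0) ((extend_left ^^ 0) [v])"
    using growth_within_length_16 by (simp add: list_all_iff)
  from growth_withinD[OF this \<open>good v\<close>] show ?thesis by simp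
qed

section \<open>Synchronizing substitutions\<close>

locale uniform_substitution =
  fixes S :: "'a set" and block :: "'a \<Rightarrow> 'b list" and k :: nat
  assumes length_block: "a \<in> S \<Longrightarrow> length (block a) = k"
    and k_pos: "0 < k"
begin

definition expand :: "'a list \<Rightarrow> 'b list" where
  "expand w = concat (map block w)"

lemma expand_Nil [simp]: "expand [] = []"
  and expand_Cons [simp]: "expand (a # w) = block a @ expand w"
  by (simp_all add: expand_def)

lemma set_expand: "set (expand w) = (\<Union>a\<in>set w. set (block a))"
  by (simp add: expand_def)

lemma length_expand: "set w \<subseteq> S \<Longrightarrow> length (expand w) = k * length w"
  by (induction w) (auto simp: length_block)

lemma drop_expand: "set w \<subseteq> S \<Longrightarrow> drop (k * q) (expand w) = expand (drop q w)"
proof (induction w arbitrary: q)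
  case (Cons a w)
  then show ?case by (cases q) (auto simp: length_block)
qed simp

lemma nth_expand:
  assumes "set w \<subseteq> S" "q < length w" "e < k"
  shows "expand w ! (k * q + e) = block (w ! q) ! e"
proof -
  have "k * q \<le> length (expand w)" "w ! q \<in> S"
    using assms by (auto simp: length_expand)
  then have "expand w ! (k * q + e) = expand (drop q w) ! e"
    using assms(1) by (simp add: drop_expand[symmetric])
  also have "\<dots> = (block (w ! q) @ expand (drop (Suc q) w)) ! e"
    using assms(2) by (simp add: Cons_nth_drop_Suc[symmetric])
  finally show ?thesis
    using assms(3) \<open>w ! q \<in> S\<close> by (simp add: nth_append length_block)
qed

lemma inj_on_expand:
  assumes "inj_on block S"
  shows "inj_on expand {w. set w \<subseteq> S}"
proof (rule inj_onI)
  fix v w assume "v \<in> {w. set w \<subseteq> S}" "w \<in> {w. set w \<subseteq> S}" and eq: "expand v = expand w"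
  then have vw: "set v \<subseteq> S" "set w \<subseteq> S" by auto
  then have "length v = length w"
    using arg_cong[OF eq, of length] k_pos by (simp add: length_expand)
  then show "v = w"
    using vw eq
  proof (induction v w rule: list_induct2)
    case (Cons a v b w)
    then have "block a = block b" "expand v = expand w"
      by (auto simp: length_block)
    with Cons show ?case using assms by (auto dest: inj_onD)
  qed simp
qed

end

definition block_pairs :: "'a list \<Rightarrow> ('a \<Rightarrow> 'b list) \<Rightarrow> ('a \<Rightarrow> 'c) \<Rightarrow> 'b list list" where
  "block_pairs as block \<pi> = [block a @ block b. a \<leftarrow> as, b \<leftarrow> as, \<pi> a \<noteq> \<pi> b]"

lemma block_pairsI:
  "\<lbrakk>a \<in> set as; b \<in> set as; \<pi> a \<noteq> \<pi> b\<rbrakk> \<Longrightarrow> block a @ block b \<in> set (block_pairs as block \<pi>)"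
  by (auto simp: block_pairs_def)

text \<open>Several symbols may stand for the same letter, which \<open>\<pi>\<close> recovers; this models a substitution
  with a choice of images. Because of \<open>2 * m \<le> k + 3\<close>, squares of period less than \<open>m\<close> fit into two
  consecutive blocks.\<close>

locale synchronizing_substitution = uniform_substitution "set as" block k
  for as :: "'a list" and block :: "'a \<Rightarrow> 'b list" and k :: nat +
  fixes \<pi> :: "'a \<Rightarrow> 'c" and m cut :: nat
  assumes m_pos: "0 < m" and window_le: "2 * m \<le> k + 3"
    and ex_other_letter: "a \<in> set as \<Longrightarrow> \<exists>b\<in>set as. \<pi> a \<noteq> \<pi> b"
    and synchronizing: "\<lbrakk>u \<in> set (block_pairs as block \<pi>); v \<in> set (block_pairs as block \<pi>);
          i < k; j < k; take m (drop i u) = take m (drop j v)\<rbrakk> \<Longrightarrow> i = j"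
    and take_cut: "\<lbrakk>a \<in> set as; b \<in> set as; take cut (block a) = take cut (block b)\<rbrakk> \<Longrightarrow> \<pi> a = \<pi> b"
    and drop_cut: "\<lbrakk>a \<in> set as; b \<in> set as; drop cut (block a) = drop cut (block b)\<rbrakk> \<Longrightarrow> \<pi> a = \<pi> b"
begin

context
  fixes w :: "'a list"
  assumes w_letters: "set w \<subseteq> set as" and w_square_free: "square_free (map \<pi> w)"
begin

lemma nth_in_letters: "q < length w \<Longrightarrow> w ! q \<in> set as"
  using w_letters by auto

lemma factor_in_block_pair:
  assumes "0 < n" "i mod k + n \<le> 2 * k" "i + n \<le> length (expand w)"
  shows "\<exists>u\<in>set (block_pairs as block \<pi>).
    take n (drop i (expand w)) = take n (drop (i mod k) u)"
proof -
  define q r where "q = i div k" and "r = i mod k"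
  have i: "i = k * q + r" by (simp add: q_def r_def)
  have q: "q < length w"
    using assms w_letters k_pos
    by (simp add: q_def div_less_iff_less_mult length_expand mult.commute)
  then have len: "length (block (w ! q)) = k" by (simp add: length_block nth_in_letters)
  have "drop i (expand w) = drop r (expand (drop q w))"
    using drop_expand[OF w_letters, of q] by (simp add: i add.commute flip: drop_drop)
  also have "expand (drop q w) = block (w ! q) @ expand (drop (Suc q) w)"
    using q by (simp flip: Cons_nth_drop_Suc)
  finally have tail: "drop i (expand w) = drop r (block (w ! q) @ expand (drop (Suc q) w))" .
  show ?thesis
  proof (cases "Suc q < length w")
    case True
    then have "\<pi> (w ! q) \<noteq> \<pi> (w ! Suc q)"
      using square_free_adjacent_neq[OF w_square_free, of q] by simp
    moreover have "length (block (w ! Suc q)) = k"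
      using True by (simp add: length_block nth_in_letters)
    moreover have "drop (Suc q) w = w ! Suc q # drop (Suc (Suc q)) w"
      using True by (simp add: Cons_nth_drop_Suc)
    ultimately show ?thesis
      using True tail len assms(2) unfolding r_def[symmetric]
      by (intro bexI[of _ "block (w ! q) @ block (w ! Suc q)"] block_pairsI)
         (simp_all add: nth_in_letters)
  next
    case False
    then have "length w = Suc q" using q by simp
    then have "r + n \<le> k" using assms(3) i w_letters by (simp add: length_expand)
    obtain b where "b \<in> set as" "\<pi> (w ! q) \<noteq> \<pi> b"
      using ex_other_letter nth_in_letters q by blast
    then show ?thesis
      using False tail len \<open>r + n \<le> k\<close> q unfolding r_def[symmetric]
      by (intro bexI[of _ "block (w ! q) @ block b"] block_pairsI) (simp_all add: nth_in_letters)
  qed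
qed

lemma window_determines_offset:
  assumes "i + m \<le> length (expand w)" "j + m \<le> length (expand w)"
    and "take m (drop i (expand w)) = take m (drop j (expand w))"
  shows "i mod k = j mod k"
proof -
  have in_pair: "e mod k + m \<le> 2 * k" for e
    using window_le mod_less_divisor[OF k_pos, of e] by linarith
  obtain u v where
    "u \<in> set (block_pairs as block \<pi>)" "take m (drop i (expand w)) = take m (drop (i mod k) u)"
    "v \<in> set (block_pairs as block \<pi>)" "take m (drop j (expand w)) = take m (drop (j mod k) v)"
    using factor_in_block_pair[OF m_pos in_pair] assms(1,2) by meson
  then show ?thesis
    using assms(3) k_pos by (intro synchronizing[of u v]) simp_all
qed

lemma long_period_multiple:
  assumes "square_at (expand w) i p" "m \<le> p"
  shows "k dvd p"
proof -
  have p: "i + 2 * p \<le> length (expand w)"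
    "take p (drop i (expand w)) = take p (drop (i + p) (expand w))"
    using assms(1) by (auto simp: square_at_def)
  then have "take m (drop i (expand w)) = take m (drop (i + p) (expand w))"
    using assms(2) by (metis min_absorb1 take_take)
  then have "i mod k = (i + p) mod k"
    using p assms(2) by (intro window_determines_offset) simp_all
  then show ?thesis by (metis add_diff_cancel_left' mod_eq_dvd_iff_nat le_add1)
qed

text \<open>A letter whose block has its part before or after \<open>cut\<close> inside the first half of a square is
  determined by that part, so it agrees with the letter one period later.\<close>

lemma letter_periodic:
  assumes sq: "square_at (expand w) i (k * l)" and "j + l < length w"
    and part: "k * j + cut \<ge> i \<and> k * j + k \<le> i + k * l \<or> k * j \<ge> i \<and> k * j + cut \<le> i + k * l"
  shows "\<pi> (w ! j) = \<pi> (w ! (j + l))"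
proof -
  let ?a = "w ! j" and ?b = "w ! (j + l)"
  have ab: "?a \<in> set as" "?b \<in> set as" and len: "length (block ?a) = k" "length (block ?b) = k"
    using assms(2) by (simp_all add: nth_in_letters length_block)
  have agree: "block ?a ! e = block ?b ! e" if "e < k" "i \<le> k * j + e" "k * j + e < i + k * l" for e
  proof -
    have "expand w ! (k * j + e) = expand w ! (k * (j + l) + e)"
      using sq that by (simp add: square_at_iff_nth algebra_simps)
    then show ?thesis using nth_expand[OF w_letters] assms(2) that(1) by simp
  qed
  from part show ?thesis
  proof
    assume "k * j + cut \<ge> i \<and> k * j + k \<le> i + k * l"
    then have "drop cut (block ?a) = drop cut (block ?b)"
      using len by (intro nth_equalityI) (auto intro!: agree)
    then show ?thesis using ab by (intro drop_cut)
  next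
    assume "k * j \<ge> i \<and> k * j + cut \<le> i + k * l"
    then have "take cut (block ?a) = take cut (block ?b)"
      using len by (intro nth_equalityI) (auto intro!: agree)
    then show ?thesis using ab by (intro take_cut)
  qed
qed

lemma letter_square:
  assumes sq: "square_at (expand w) i (k * l)"
  shows "\<exists>s. square_at (map \<pi> w) s l"
proof -
  define q r where "q = i div k" and "r = i mod k"
  have i: "i = k * q + r" "r < k" using k_pos by (simp_all add: q_def r_def)
  define s where "s = (if r \<le> cut then q else Suc q)"
  have "k * (q + 2 * l) + r \<le> k * length w"
    using sq w_letters by (simp add: square_at_def length_expand i algebra_simps)
  then have "k * (q + 2 * l) \<le> k * length w" "\<not> r \<le> cut \<longrightarrow> k * (q + 2 * l) < k * length w"
    by linarith+
  then have end_le: "s + 2 * l \<le> length w"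
    using k_pos by (auto simp: s_def)
  moreover have "\<pi> (w ! j) = \<pi> (w ! (j + l))" if j: "s \<le> j" "j < s + l" for j
  proof (rule letter_periodic[OF sq])
    show "j + l < length w" using j end_le by simp
    show "k * j + cut \<ge> i \<and> k * j + k \<le> i + k * l \<or> k * j \<ge> i \<and> k * j + cut \<le> i + k * l"
    proof (cases "r \<le> cut")
      case True
      have "k * q \<le> k * j" "k * Suc j \<le> k * (q + l)"
        using True j by (intro mult_le_mono2; simp add: s_def)+
      with True show ?thesis unfolding i(1) distrib_left mult_Suc_right by linarith
    next
      case False
      have "k * Suc q \<le> k * j" "k * j \<le> k * (q + l)"
        using False j by (intro mult_le_mono2; simp add: s_def)+
      with False i(2) show ?thesis unfolding i(1) distrib_left mult_Suc_right by linarith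
    qed
  qed
  moreover have "0 < l" using sq by (cases l) (auto simp: square_at_def)
  ultimately have "square_at (map \<pi> w) s l" by (auto simp: square_at_iff_nth)
  then show ?thesis ..
qed

lemma period_expand_less:
  assumes sq: "square_at (expand w) i p"
  shows "p < m"
proof (rule ccontr)
  assume "\<not> p < m"
  then obtain l where "p = k * l" using long_period_multiple[OF sq] by auto
  then show False
    using letter_square w_square_free sq by (auto simp: square_free_iff_square_at)
qed

theorem squares_within_expand:
  assumes pairs: "\<forall>u\<in>set (block_pairs as block \<pi>). squares_within A u"
  shows "squares_within A (expand w)"
  unfolding squares_within_def
proof (intro allI impI)
  fix s assume s: "sublist s (expand w) \<and> is_square s"
  then obtain i p where sq: "square_at (expand w) i p" and s_eq: "s = take (2 * p) (drop i (expand w))"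
    unfolding sublist_square_iff by blast
  then have "0 < p" "i + 2 * p \<le> length (expand w)" by (simp_all add: square_at_def)
  moreover have "i mod k + 2 * p \<le> 2 * k"
    using period_expand_less[OF sq] window_le mod_less_divisor[OF k_pos, of i] by linarith
  ultimately obtain u where u: "u \<in> set (block_pairs as block \<pi>)" "s = take (2 * p) (drop (i mod k) u)"
    using factor_in_block_pair[of "2 * p" i] s_eq by auto
  then have "sublist s u" by (metis sublist_drop sublist_order.order.trans sublist_take)
  with u(1) pairs s show "s \<in> A" by (auto simp: squares_within_def)
qed

end

end

subsection \<open>Checking synchronization\<close>

fun all_labelled :: "'l \<Rightarrow> ('l \<times> 'b) list \<Rightarrow> bool" where
  "all_labelled i [] \<longleftrightarrow> True"
| "all_labelled i ((j, x) # ps) \<longleftrightarrow> (if j = i then all_labelled i ps else False)"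

lemma all_labelledD: "all_labelled i ps \<Longrightarrow> (j, x) \<in> set ((i, y) # ps) \<Longrightarrow> j = i"
  by (induction i ps rule: all_labelled.induct) (auto split: if_splits)

fun tails_after :: "'b \<Rightarrow> ('l \<times> 'b list) list \<Rightarrow> ('l \<times> 'b list) list" where
  "tails_after c [] = []"
| "tails_after c ((i, []) # ps) = tails_after c ps"
| "tails_after c ((i, x # xs) # ps) =
     (if x = c then (i, xs) # tails_after c ps else tails_after c ps)"

lemma set_tails_after: "set (tails_after c ps) = {(i, xs). (i, c # xs) \<in> set ps}"
  by (induction c ps rule: tails_after.induct) auto

fun words_determine_labels :: "'b list \<Rightarrow> nat \<Rightarrow> ('l \<times> 'b list) list \<Rightarrow> bool" where
  "words_determine_labels cs n [] \<longleftrightarrow> True"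
| "words_determine_labels cs 0 ((i, x) # ps) \<longleftrightarrow> all_labelled i ps"
| "words_determine_labels cs (Suc n) ((i, x) # ps) \<longleftrightarrow>
     (if all_labelled i ps then True
      else list_all (\<lambda>c. words_determine_labels cs n (tails_after c ((i, x) # ps))) cs)"

lemma words_determine_labelsD:
  assumes "words_determine_labels cs n ps" "\<forall>(i, x)\<in>set ps. length x = n \<and> set x \<subseteq> set cs"
    and "(i, x) \<in> set ps" "(j, x) \<in> set ps"
  shows "i = j"
  using assms
proof (induction cs n ps arbitrary: x rule: words_determine_labels.induct)
  case (2 cs h y ps)
  then show ?case using all_labelledD[of h ps _ x y] by (metis words_determine_labels.simps(2))
next
  case (3 cs n h y ps)
  show ?case
  proof (cases "all_labelled h ps")
    case True
    then show ?thesis using all_labelledD[of h ps _ x y] "3.prems"(3,4) by metis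
  next
    case False
    obtain c xs where x: "x = c # xs" "c \<in> set cs"
      using "3.prems"(2,3) by (cases x) auto
    then have "words_determine_labels cs n (tails_after c ((h, y) # ps))"
      using "3.prems"(1) False by (simp add: list_all_iff)
    then show ?thesis
    proof (rule "3.IH"[OF False \<open>c \<in> set cs\<close>])
      show "\<forall>(i, x)\<in>set (tails_after c ((h, y) # ps)). length x = n \<and> set x \<subseteq> set cs"
        using "3.prems"(2) unfolding set_tails_after by fastforce
      show "(i, xs) \<in> set (tails_after c ((h, y) # ps))" "(j, xs) \<in> set (tails_after c ((h, y) # ps))"
        using "3.prems"(3,4) x(1) unfolding set_tails_after by simp_all
    qed
  qed
qed simp

text \<open>Integer labels, because \<open>code_simp\<close> represents natural numbers in unary; \<open>remdups\<close>, because the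
  blocks have long common prefixes and suffixes.\<close>

definition windows :: "nat \<Rightarrow> nat \<Rightarrow> 'b list list \<Rightarrow> (int \<times> 'b list) list" where
  "windows k m us = [(int i, x). i \<leftarrow> [0..<k], x \<leftarrow> remdups (map (\<lambda>u. take m (drop i u)) us)]"

lemma set_windows: "set (windows k m us) = {(int i, take m (drop i u)) |i u. i < k \<and> u \<in> set us}"
  by (auto simp: windows_def)

lemma synchronizing_if_windows_determine_labels:
  assumes "words_determine_labels cs m (windows k m us)"
    and "\<forall>u\<in>set us. k + m \<le> Suc (length u) \<and> set u \<subseteq> set cs"
    and "u \<in> set us" "v \<in> set us" "i < k" "j < k" "take m (drop i u) = take m (drop j v)"
  shows "i = j"
proof -
  have "length (take m (drop i u)) = m \<and> set (take m (drop i u)) \<subseteq> set cs"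
    if "i < k" "u \<in> set us" for i u
    using that assms(2) by (auto dest!: in_set_takeD in_set_dropD)
  then have "\<forall>(i, x)\<in>set (windows k m us). length x = m \<and> set x \<subseteq> set cs"
    by (auto simp: set_windows)
  moreover have "(int i, take m (drop i u)) \<in> set (windows k m us)"
    "(int j, take m (drop i u)) \<in> set (windows k m us)"
    using assms(3-) unfolding set_windows by blast+
  ultimately have "int i = int j" by (rule words_determine_labelsD[OF assms(1)])
  then show ?thesis by simp
qed

section \<open>Lower bound\<close>

subsection \<open>Long square-free ternary words\<close>

definition leech_block :: "nat \<Rightarrow> nat list" where
  "leech_block a =
    (if a = 0 then [0,1,2,1,0,2,1,2,0,1,2,1,0]
     else if a = 1 then [1,2,0,2,1,0,2,0,1,2,0,2,1]
     else [2,0,1,0,2,1,0,1,2,0,1,0,2])"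

lemma leech_windows:
  "words_determine_labels [0,1,2] 8 (windows 13 8 (block_pairs [0,1,2] leech_block (\<lambda>a. a)))"
  by code_simp

lemma leech_block_pairs: "list_all square_free (block_pairs [0,1,2] leech_block (\<lambda>a. a))"
  by code_simp

interpretation leech: synchronizing_substitution "[0,1,2]" leech_block 13 "\<lambda>a. a" 8 1
proof
  show "i = j" if "u \<in> set (block_pairs [0,1,2] leech_block (\<lambda>a. a))"
    "v \<in> set (block_pairs [0,1,2] leech_block (\<lambda>a. a))"
    "i < 13" "j < 13" "take 8 (drop i u) = take 8 (drop j v)" for u v i j
    by (rule synchronizing_if_windows_determine_labels[OF leech_windows _ that])
       (auto simp: block_pairs_def leech_block_def)
qed (auto simp: leech_block_def)

lemma square_free_leech_expand:
  assumes "set w \<subseteq> {0,1,2}" "square_free w"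
  shows "square_free (leech.expand w)"
  using leech.squares_within_expand[of w "{}"] assms leech_block_pairs by (simp add: list_all_iff)

lemma set_leech_expand: "set (leech.expand w) \<subseteq> {0,1,2}"
  by (auto simp: leech.set_expand leech_block_def split: if_splits)

lemma ex_long_ternary_square_free:
  "\<exists>w. set w \<subseteq> {0,1,2 :: nat} \<and> square_free w \<and> n < length w"
proof (induction n)
  case 0
  have "square_free [0 :: nat]" by code_simp
  then show ?case by (intro exI[of _ "[0]"]) simp
next
  case (Suc n)
  then obtain w where "set w \<subseteq> {0,1,2 :: nat}" "square_free w" "n < length w" by blast
  then show ?case
    using set_leech_expand square_free_leech_expand[of w] leech.length_expand[of w]
    by (intro exI[of _ "leech.expand w"]) auto
qed

lemma length_le_count_leech_expand: "length w \<le> count_list (leech.expand w) 0"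
proof (induction w)
  case (Cons a w)
  have "1 \<le> count_list (leech_block a) 0" by (simp add: leech_block_def)
  with Cons show ?case by simp
qed simp

lemma ex_ternary_square_free_count:
  obtains w where "set w \<subseteq> {0,1,2 :: nat}" "square_free w" "length w = 13 * n" "n \<le> count_list w 0"
proof -
  obtain v where v: "set v \<subseteq> {0,1,2 :: nat}" "square_free v" "n < length v"
    using ex_long_ternary_square_free by blast
  define w where "w = leech.expand (take n v)"
  have "set (take n v) \<subseteq> {0,1,2}" using set_take_subset v(1) by (rule order.trans)
  moreover have "square_free (take n v)" using v(2) sublist_take by (rule squares_within_sublist)
  ultimately have "square_free w" "length w = 13 * n"
    using v by (simp_all add: w_def square_free_leech_expand leech.length_expand)
  moreover have "n \<le> count_list w 0"
    using length_le_count_leech_expand[of "take n v"] v(3) by (simp add: w_def)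
  moreover have "set w \<subseteq> {0,1,2}" unfolding w_def by (rule set_leech_expand)
  ultimately show thesis using that by blast
qed

subsection \<open>Binary images of square-free ternary words\<close>

text \<open>The symbols \<open>0\<close> and \<open>3\<close> both stand for the letter \<open>0\<close>, hence the reduction modulo \<open>3\<close>. The blocks
  were found by computer search.\<close>

definition binary_block :: "nat \<Rightarrow> nat list" where
  "binary_block a =
    (if a = 0 then
        [0,0,0,1,1,1,0,0,1,0,1,1,0,0,1,1,1,0,0,0,1,0,1,1,1,0,0,1,0,1,1,0,0,0,
         1,1,1,0,0,1,0,1,1,1,0,0,0,1,0,1,1,0,0,1,1,1,0,0,0,1,1,0,0,1,0,1,1]
     else if a = 1 then
        [0,0,0,1,1,1,0,0,1,0,1,1,0,0,1,1,1,0,0,0,1,1,0,0,1,0,1,1,1,0,0,0,1,0,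
         1,1,0,0,0,1,1,1,0,0,1,0,1,1,0,0,0,1,0,1,1,1,0,0,0,1,1,0,0,1,0,1,1]
     else if a = 2 then
        [0,0,0,1,1,1,0,0,1,0,1,1,0,0,1,1,1,0,0,0,1,1,0,0,1,0,1,1,1,0,0,0,1,0,
         1,1,0,0,1,1,1,0,0,0,1,0,1,1,1,0,0,1,0,1,1,0,0,1,1,1,0,0,0,1,0,1,1]
     else
        [0,0,0,1,1,1,0,0,1,0,1,1,1,0,0,0,1,1,0,0,1,0,1,1,0,0,0,1,0,1,1,1,0,0,
         0,1,1,0,0,1,0,1,1,1,0,0,0,1,0,1,1,0,0,1,1,1,0,0,0,1,1,0,0,1,0,1,1])"

lemma binary_windows:
  "words_determine_labels [0,1] 35
     (windows 67 35 (block_pairs [0,1,2,3] binary_block (\<lambda>a. a mod 3)))"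
  by code_simp

lemma binary_block_pairs:
  "list_all (squares_within allowed_squares) (block_pairs [0,1,2,3] binary_block (\<lambda>a. a mod 3))"
  by code_simp

interpretation binary: synchronizing_substitution "[0,1,2,3]" binary_block 67 "\<lambda>a. a mod 3" 35 39
proof
  show "i = j" if "u \<in> set (block_pairs [0,1,2,3] binary_block (\<lambda>a. a mod 3))"
    "v \<in> set (block_pairs [0,1,2,3] binary_block (\<lambda>a. a mod 3))"
    "i < 67" "j < 67" "take 35 (drop i u) = take 35 (drop j v)" for u v i j
    by (rule synchronizing_if_windows_determine_labels[OF binary_windows _ that])
       (auto simp: block_pairs_def binary_block_def)
qed (auto simp: binary_block_def)

lemma good_binary_expand:
  assumes "set u \<subseteq> {0,1,2,3}" "square_free (map (\<lambda>a. a mod 3) u)"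
  shows "good (binary.expand u)"
  unfolding good_def
proof
  show "binary_word (binary.expand u)"
    by (auto simp: binary_word_def binary.set_expand binary_block_def split: if_splits)
  show "squares_within allowed_squares (binary.expand u)"
    using binary.squares_within_expand assms binary_block_pairs by (simp add: list_all_iff)
qed

definition lifts :: "'a set \<Rightarrow> ('a \<Rightarrow> 'b) \<Rightarrow> 'b list \<Rightarrow> 'a list set" where
  "lifts S \<pi> w = {u. set u \<subseteq> S \<and> map \<pi> u = w}"

lemma card_lifts: "card (lifts S \<pi> w) = (\<Prod>c\<leftarrow>w. card {a \<in> S. \<pi> a = c})"
proof (induction w)
  case Nil
  have "lifts S \<pi> [] = {[]}" by (auto simp: lifts_def)
  then show ?case by simp
next
  case (Cons c w)
  have "lifts S \<pi> (c # w) = (\<lambda>(a, u). a # u) ` ({a \<in> S. \<pi> a = c} \<times> lifts S \<pi> w)"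
    by (auto simp: lifts_def Cons_eq_map_conv image_iff)
  moreover have "inj_on (\<lambda>(a, u). a # u) ({a \<in> S. \<pi> a = c} \<times> lifts S \<pi> w)"
    by (auto simp: inj_on_def)
  ultimately show ?case using Cons.IH by (simp add: card_image card_cartesian_product)
qed

lemma card_lifts_mod_3:
  "set w \<subseteq> {0,1,2} \<Longrightarrow> card (lifts {0,1,2,3} (\<lambda>a. a mod 3) w) = 2 ^ count_list w (0 :: nat)"
  unfolding card_lifts
proof (induction w)
  case (Cons c w)
  have "\<forall>c\<in>{0,1,2 :: nat}. card {a \<in> {0,1,2,3}. a mod 3 = c} = (if c = 0 then 2 else 1)"
    by (simp add: conj_disj_distribR Collect_disj_eq Collect_conv_if)
  then have "card {a \<in> {0,1,2,3}. a mod 3 = c} = (if c = 0 then 2 else 1)"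
    by (rule bspec) (use Cons.prems in simp)
  moreover have "set w \<subseteq> {0,1,2}" using Cons.prems by simp
  ultimately show ?case using Cons.IH by simp
qed simp

lemma two_power_le_H: "2 ^ n \<le> H (871 * n)"
proof -
  obtain w where w: "set w \<subseteq> {0,1,2 :: nat}" "square_free w" "length w = 13 * n" "n \<le> count_list w 0"
    using ex_ternary_square_free_count .
  let ?U = "lifts {0,1,2,3} (\<lambda>a. a mod 3) w"
  have "inj_on binary_block {0,1,2,3}"
    by (auto simp: inj_on_def binary_block_def)
  then have inj: "inj_on binary.expand ?U"
    using binary.inj_on_expand by (auto simp: lifts_def elim!: inj_on_subset)
  have sub: "binary.expand ` ?U \<subseteq> good_words.extensions (871 * n) []"
  proof (rule image_subsetI)
    fix u assume "u \<in> ?U"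
    then have u: "set u \<subseteq> {0,1,2,3}" "map (\<lambda>a. a mod 3) u = w" by (auto simp: lifts_def)
    then have "length u = 13 * n" using w(3) by (metis length_map)
    then show "binary.expand u \<in> good_words.extensions (871 * n) []"
      using u w(2) good_binary_expand[of u] binary.length_expand[of u]
      by (simp add: good_words.extensions_def)
  qed
  have "(2 :: nat) ^ n \<le> 2 ^ count_list w 0" using w(4) by (intro power_increasing) auto
  also have "\<dots> = card (binary.expand ` ?U)"
    using card_lifts_mod_3[OF w(1)] card_image[OF inj] by (simp only:)
  also have "\<dots> \<le> H (871 * n)"
    unfolding H_eq_complexity good_words.complexity_eq_card_extensions
    using sub by (intro card_mono good_words.finite_extensions)
  finally show ?thesis .
qed

lemma power_1_0006_le_two: "(1.0006 :: real) ^ 871 \<le> 2"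
proof -
  have "(1.0006 :: real) ^ 871 \<le> exp 0.0006 ^ 871"
    using exp_ge_add_one_self[of "0.0006 :: real"] by (intro power_mono) auto
  also have "\<dots> = exp (871 * 0.0006)" by (simp add: exp_of_nat_mult[symmetric])
  also have "\<dots> \<le> 1 + 871 * 0.0006 + (871 * 0.0006)\<^sup>2" by (rule exp_bound) simp_all
  also have "\<dots> \<le> (2 :: real)" by (simp add: power2_eq_square)
  finally show ?thesis .
qed

theorem theorem12:
  "(\<lambda>n. real (H n)) \<in> \<Omega>(\<lambda>n. (1.0006 :: real) ^ n) \<and>
   (\<lambda>n. real (H n)) \<in> O(\<lambda>n. (1.135 :: real) ^ n)"
proof
  have "2 ^ n \<le> real (H (871 * n))" for n
    using two_power_le_H[of n] by (simp add: numeral_power_le_of_nat_cancel_iff)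
  then show "(\<lambda>n. real (H n)) \<in> \<Omega>(\<lambda>n. (1.0006 :: real) ^ n)"
    using power_1_0006_le_two unfolding H_eq_complexity
    by (intro good_words.complexity_bigomega_if_power_le[of 2 871]) auto
  show "(\<lambda>n. real (H n)) \<in> O(\<lambda>n. (1.135 :: real) ^ n)"
    using ex_few_extensions unfolding H_eq_complexity
    by (intro good_words.complexity_bigo_if_local_growth[of _ 16 33]) auto
qed

end
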